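(* Every strongly consistent canonical system is coherent.
   Context: $\mathcal{L}$ is a propositional language with atoms $p_1,p_2,\ldots$ and set of formulas $\mathcal{F}$. A sequent is $\Gamma\Rightarrow E$ with $\Gamma$ a finite set of formulas and $E$ a set of formulas with at most one element ($\Rightarrow$ alone denotes the empty sequent). A clause is a sequent of atoms. An $\mathcal{L}$-substitution is a map $\sigma:\mathcal{F}\to\mathcal{F}$ commuting with all connectives, extended pointwise to sets. A canonical right-introduction rule for an $n$-ary connective $\diamond$ is $\{\Pi_i\Rightarrow E_i\}_{1\le i\le m}/\ \Rightarrow\diamond(p_1,\dots,p_n)$ with $m\ge0$ and $\Pi_i\cup E_i\subseteq\{p_1,\dots,p_n\}$; an application infers $\Gamma\Rightarrow\sigma(\diamond(p_1,\dots,p_n))$ from $\Gamma,\sigma(\Pi_i)\Rightarrow\sigma(E_i)$ ($1\le i\le m$), for any finite $\Gamma$ and substitution $\sigma$. A canonical left-introduction rule is $\langle\{\Pi_i\Rightarrow E_i\}_{1\le i\le m},\{\Sigma_j\Rightarrow\}_{1\le j\le k}\rangle/\ \diamond(p_1,\dots,p_n)\Rightarrow$ with all atoms among $p_1,\dots,p_n$; an application infers $\Gamma,\sigma(\diamond(p_1,\dots,p_n))\Rightarrow E$ from $\Gamma,\sigma(\Pi_i)\Rightarrow\sigma(E_i)$ and $\Gamma,\sigma(\Sigma_j)\Rightarrow E$, for any sequent $\Gamma\Rightarrow E$ and substitution $\sigma$. A canonical system has axioms $\varphi\Rightarrow\varphi$, weakening (from $\Gamma\Rightarrow E$ infer $\Gamma,\Delta\Rightarrow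 E$; from $\Gamma\Rightarrow$ infer $\Gamma\Rightarrow\psi$), cut (from $\Gamma\Rightarrow\varphi$ and $\Delta,\varphi\Rightarrow E$ infer $\Gamma,\Delta\Rightarrow E$), and a set of canonical right- and left-introduction rules. $\mathcal{S}\vdash^{seq}_{\mathbf G}s$ means $s$ is derivable in $\mathbf G$ from the sequents of $\mathcal S$ as extra axioms. $\mathbf G$ is strongly consistent iff $(\Rightarrow p_1),(p_2\Rightarrow)\not\vdash^{seq}_{\mathbf G}\ \Rightarrow$. A classical assignment $u$ satisfies a clause $\Pi\Rightarrow E$ iff $u(p)=f$ for some $p\in\Pi$ or $E=\{q\}$ with $u(q)=t$; a set of clauses is classically inconsistent iff no assignment satisfies all of them. $\mathbf G$ is coherent iff for every connective $\diamond$, whenever $\mathbf G$ contains a left rule $\langle S_1,S_2\rangle/\diamond(p_1,\dots,p_n)\Rightarrow$ and a right rule $S_3/\Rightarrow\diamond(p_1,\dots,p_n)$, the set $S_1\cup S_2\cup S_3$ is classically inconsistent. *)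

theory Defs
  imports Main
begin

text \<open>The connectives of the language are the elements of \<^typ>\<open>'c\<close>, with arities given by a
  function \<open>ar\<close>. Atoms are indexed from 0: \<open>Atom i\<close> is the atom $p_{i+1}$. The datatype also
  contains applications to the wrong number of arguments; the set of formulas of the language
  is \<open>formulas ar\<close>.\<close>

datatype 'c form = Atom nat | Conn 'c "'c form list"

inductive_set formulas :: "('c \<Rightarrow> nat) \<Rightarrow> 'c form set" for ar :: "'c \<Rightarrow> nat" where
  Atom: "Atom i \<in> formulas ar"
| Conn: "length \<phi>s = ar c \<Longrightarrow> (\<And>\<phi>. \<phi> \<in> set \<phi>s \<Longrightarrow> \<phi> \<in> formulas ar)
    \<Longrightarrow> Conn c \<phi>s \<in> formulas ar"

text \<open>The pair \<open>(\<Gamma>, E)\<close> is the sequent \<open>\<Gamma> \<Rightarrow> E\<close>; the at most one-element set on the right is an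
  option.\<close>

type_synonym 'c sequent = "'c form set \<times> 'c form option"

definition context_of :: "('c \<Rightarrow> nat) \<Rightarrow> 'c form set \<Rightarrow> bool" where
  "context_of ar \<Gamma> \<longleftrightarrow> finite \<Gamma> \<and> \<Gamma> \<subseteq> formulas ar"

definition is_sequent :: "('c \<Rightarrow> nat) \<Rightarrow> 'c sequent \<Rightarrow> bool" where
  "is_sequent ar = (\<lambda>(\<Gamma>, E). context_of ar \<Gamma> \<and> set_option E \<subseteq> formulas ar)"

definition clause_over :: "nat \<Rightarrow> 'c sequent \<Rightarrow> bool" where
  "clause_over n = (\<lambda>(\<Pi>, E). \<Pi> \<union> set_option E \<subseteq> Atom ` {..<n})"

definition is_substitution :: "('c \<Rightarrow> nat) \<Rightarrow> ('c form \<Rightarrow> 'c form) \<Rightarrow> bool" where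
  "is_substitution ar \<sigma> \<longleftrightarrow>
     (\<forall>\<phi>\<in>formulas ar. \<sigma> \<phi> \<in> formulas ar) \<and>
     (\<forall>c \<phi>s. Conn c \<phi>s \<in> formulas ar \<longrightarrow> \<sigma> (Conn c \<phi>s) = Conn c (map \<sigma> \<phi>s))"

text \<open>\<open>(c, S)\<close> in \<open>right_rules\<close> is the rule with premises \<open>S\<close> introducing \<open>c\<close> on the right;
  \<open>(c, S\<^sub>1, S\<^sub>2)\<close> in \<open>left_rules\<close> introduces \<open>c\<close> on the left, where the right-hand side of the
  conclusion is added to the premises in \<open>S\<^sub>2\<close> only.\<close>

record 'c system =
  right_rules :: "('c \<times> 'c sequent set) set"
  left_rules :: "('c \<times> 'c sequent set \<times> 'c sequent set) set"

definition canonical_right_rule :: "('c \<Rightarrow> nat) \<Rightarrow> 'c \<times> 'c sequent set \<Rightarrow> bool" where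
  "canonical_right_rule ar = (\<lambda>(c, S). finite S \<and> (\<forall>s\<in>S. clause_over (ar c) s))"

definition canonical_left_rule ::
    "('c \<Rightarrow> nat) \<Rightarrow> 'c \<times> 'c sequent set \<times> 'c sequent set \<Rightarrow> bool" where
  "canonical_left_rule ar = (\<lambda>(c, S\<^sub>1, S\<^sub>2). finite S\<^sub>1 \<and> finite S\<^sub>2 \<and>
     (\<forall>s\<in>S\<^sub>1 \<union> S\<^sub>2. clause_over (ar c) s) \<and> (\<forall>s\<in>S\<^sub>2. snd s = None))"

definition canonical_system :: "('c \<Rightarrow> nat) \<Rightarrow> 'c system \<Rightarrow> bool" where
  "canonical_system ar G \<longleftrightarrow>
     (\<forall>r\<in>right_rules G. canonical_right_rule ar r) \<and>
     (\<forall>r\<in>left_rules G. canonical_left_rule ar r)"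

definition principal :: "('c \<Rightarrow> nat) \<Rightarrow> 'c \<Rightarrow> 'c form" where
  "principal ar c = Conn c (map Atom [0..<ar c])"

inductive derivable :: "('c \<Rightarrow> nat) \<Rightarrow> 'c system \<Rightarrow> 'c sequent set \<Rightarrow> 'c sequent \<Rightarrow> bool"
  for ar :: "'c \<Rightarrow> nat" and G :: "'c system" and \<S> :: "'c sequent set" where
  hyp: "s \<in> \<S> \<Longrightarrow> derivable ar G \<S> s"
| ax: "\<phi> \<in> formulas ar \<Longrightarrow> derivable ar G \<S> ({\<phi>}, Some \<phi>)"
| weak_left: "derivable ar G \<S> (\<Gamma>, E) \<Longrightarrow> context_of ar \<Delta> \<Longrightarrow> derivable ar G \<S> (\<Gamma> \<union> \<Delta>, E)"
| weak_right: "derivable ar G \<S> (\<Gamma>, None) \<Longrightarrow> \<psi> \<in> formulas ar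
    \<Longrightarrow> derivable ar G \<S> (\<Gamma>, Some \<psi>)"
| cut: "derivable ar G \<S> (\<Gamma>, Some \<phi>) \<Longrightarrow> derivable ar G \<S> (\<Delta> \<union> {\<phi>}, E)
    \<Longrightarrow> derivable ar G \<S> (\<Gamma> \<union> \<Delta>, E)"
| right: "(c, S) \<in> right_rules G \<Longrightarrow> is_substitution ar \<sigma> \<Longrightarrow> context_of ar \<Gamma>
    \<Longrightarrow> (\<And>\<Pi> D. (\<Pi>, D) \<in> S \<Longrightarrow> derivable ar G \<S> (\<Gamma> \<union> \<sigma> ` \<Pi>, map_option \<sigma> D))
    \<Longrightarrow> derivable ar G \<S> (\<Gamma>, Some (\<sigma> (principal ar c)))"
| left: "(c, S\<^sub>1, S\<^sub>2) \<in> left_rules G \<Longrightarrow> is_substitution ar \<sigma> \<Longrightarrow> is_sequent ar (\<Gamma>, E)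
    \<Longrightarrow> (\<And>\<Pi> D. (\<Pi>, D) \<in> S\<^sub>1 \<Longrightarrow> derivable ar G \<S> (\<Gamma> \<union> \<sigma> ` \<Pi>, map_option \<sigma> D))
    \<Longrightarrow> (\<And>\<Sigma>. (\<Sigma>, None) \<in> S\<^sub>2 \<Longrightarrow> derivable ar G \<S> (\<Gamma> \<union> \<sigma> ` \<Sigma>, E))
    \<Longrightarrow> derivable ar G \<S> (\<Gamma> \<union> {\<sigma> (principal ar c)}, E)"

definition strongly_consistent :: "('c \<Rightarrow> nat) \<Rightarrow> 'c system \<Rightarrow> bool" where
  "strongly_consistent ar G \<longleftrightarrow>
     \<not> derivable ar G {({}, Some (Atom 0)), ({Atom 1}, None)} ({}, None)"

definition satisfies :: "(nat \<Rightarrow> bool) \<Rightarrow> 'c sequent \<Rightarrow> bool" where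
  "satisfies u = (\<lambda>(\<Pi>, E). (\<exists>i. Atom i \<in> \<Pi> \<and> \<not> u i) \<or> (\<exists>i. E = Some (Atom i) \<and> u i))"

definition classically_inconsistent :: "'c sequent set \<Rightarrow> bool" where
  "classically_inconsistent S \<longleftrightarrow> \<not> (\<exists>u. \<forall>s\<in>S. satisfies u s)"

definition coherent :: "'c system \<Rightarrow> bool" where
  "coherent G \<longleftrightarrow> (\<forall>c S\<^sub>1 S\<^sub>2 S\<^sub>3. (c, S\<^sub>1, S\<^sub>2) \<in> left_rules G \<longrightarrow> (c, S\<^sub>3) \<in> right_rules G
     \<longrightarrow> classically_inconsistent (S\<^sub>1 \<union> S\<^sub>2 \<union> S\<^sub>3))"

end

theory Submission
  imports Defs
begin

text \<open>If an assignment \<open>u\<close> satisfied all premises of a right rule and a left rule for the same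
  connective, substituting $p_1$ for the true atoms and $p_2$ for the false ones would make every
  premise a weakening of $\Rightarrow p_1$ or of $p_2 \Rightarrow$. Applying both rules and cutting
  the introduced formula would then derive the empty sequent.\<close>

primrec atom_subst :: "(nat \<Rightarrow> 'c form) \<Rightarrow> 'c form \<Rightarrow> 'c form" where
  "atom_subst f (Atom i) = f i"
| "atom_subst f (Conn c \<phi>s) = Conn c (map (atom_subst f) \<phi>s)"

lemma atom_subst_in_formulas:
  assumes "\<And>i. f i \<in> formulas ar" and "\<phi> \<in> formulas ar"
  shows "atom_subst f \<phi> \<in> formulas ar"
  using assms(2) by induction (auto intro!: assms(1) formulas.Conn)

lemma is_substitution_atom_subst:
  assumes "\<And>i. f i \<in> formulas ar"
  shows "is_substitution ar (atom_subst f)"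
  using atom_subst_in_formulas[of f ar] assms by (simp add: is_substitution_def)

lemma derivable_superset:
  assumes "derivable ar G \<S> (\<Gamma>, E)" and "\<Gamma> \<subseteq> \<Delta>" and "context_of ar \<Delta>"
  shows "derivable ar G \<S> (\<Delta>, E)"
  using derivable.weak_left[OF assms(1,3)] assms(2) by (simp add: sup.absorb2)

text \<open>With indices starting at 0, \<open>Atom 0\<close> and \<open>Atom 1\<close> are the two
  atoms in the extra axioms of \<open>strongly_consistent\<close>: the first is assumed outright,
  the second refuted.\<close>

definition truth_subst :: "(nat \<Rightarrow> bool) \<Rightarrow> 'c form \<Rightarrow> 'c form" where
  "truth_subst u = atom_subst (\<lambda>i. if u i then Atom 0 else Atom 1)"

lemma is_substitution_truth_subst: "is_substitution ar (truth_subst u)"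
  unfolding truth_subst_def by (rule is_substitution_atom_subst) (auto intro: formulas.Atom)

lemma truth_subst_Atom [simp]: "truth_subst u (Atom i) = (if u i then Atom 0 else Atom 1)"
  by (simp add: truth_subst_def)

text \<open>A false atom on the left becomes \<open>Atom 1\<close>, a true atom on the right becomes
  \<open>Atom 0\<close>. Either one already gives an extra axiom inside the image of the clause, and
  weakening supplies the rest.\<close>

lemma derivable_truth_subst_clause:
  assumes "clause_over n (\<Pi>, D)" and "satisfies u (\<Pi>, D)"
    and true: "({}, Some (Atom 0)) \<in> \<S>" and false: "({Atom 1}, None) \<in> \<S>"
  shows "derivable ar G \<S> (truth_subst u ` \<Pi>, map_option (truth_subst u) D)"
proof -
  have atoms: "\<Pi> \<subseteq> Atom ` {..<n}" "set_option D \<subseteq> Atom ` {..<n}"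
    using assms(1) by (auto simp: clause_over_def)
  \<comment> \<open>Left weakening needs a finite context; finiteness comes from the bound
    \<open>n\<close> on the atoms of the clause.\<close>
  have ctx: "context_of ar (truth_subst u ` \<Pi>)"
    using atoms(1) finite_subset[OF atoms(1)]
    by (auto simp: context_of_def intro: formulas.Atom dest!: subsetD)
  from assms(2) consider i where "Atom i \<in> \<Pi>" "\<not> u i" | i where "D = Some (Atom i)" "u i"
    by (auto simp: satisfies_def)
  then show ?thesis
  proof cases
    case 1
    then have "{Atom 1} \<subseteq> truth_subst u ` \<Pi>"
      by force
    then have "derivable ar G \<S> (truth_subst u ` \<Pi>, None)"
      using derivable_superset[OF derivable.hyp[OF false]] ctx by blast
    \<comment> \<open>A right-hand side, if present, is an atom, so its image is a formula that
      right weakening can add.\<close>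
    then show ?thesis
      using atoms(2) by (cases D) (auto intro!: derivable.weak_right formulas.Atom)
  next
    case 2
    then show ?thesis
      using derivable_superset[OF derivable.hyp[OF true]] ctx by simp
  qed
qed

theorem theorem4p10:
  fixes ar :: "'c \<Rightarrow> nat" and G :: "'c system"
  assumes "canonical_system ar G"
    and "strongly_consistent ar G"
  shows "coherent G"
  unfolding coherent_def classically_inconsistent_def
proof (intro allI impI notI)
  fix c S\<^sub>1 S\<^sub>2 S\<^sub>3
  assume L: "(c, S\<^sub>1, S\<^sub>2) \<in> left_rules G" and R: "(c, S\<^sub>3) \<in> right_rules G"
  assume "\<exists>u. \<forall>s\<in>S\<^sub>1 \<union> S\<^sub>2 \<union> S\<^sub>3. satisfies u s"
  then obtain u where u: "\<And>s. s \<in> S\<^sub>1 \<union> S\<^sub>2 \<union> S\<^sub>3 \<Longrightarrow> satisfies u s"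
    by blast
  let ?\<sigma> = "truth_subst u"
  let ?\<S> = "{({}, Some (Atom 0)), ({Atom 1}, None)} :: 'c sequent set"
  have over: "clause_over (ar c) s" if "s \<in> S\<^sub>1 \<union> S\<^sub>2 \<union> S\<^sub>3" for s
    using assms(1) L R that
    by (fastforce simp: canonical_system_def canonical_left_rule_def canonical_right_rule_def)
  have premise: "derivable ar G ?\<S> ({} \<union> ?\<sigma> ` \<Pi>, map_option ?\<sigma> D)"
    if "(\<Pi>, D) \<in> S\<^sub>1 \<union> S\<^sub>2 \<union> S\<^sub>3" for \<Pi> D
    using derivable_truth_subst_clause[OF over[OF that] u[OF that]] by simp
  have right: "derivable ar G ?\<S> ({}, Some (?\<sigma> (principal ar c)))"
    by (rule derivable.right[OF R is_substitution_truth_subst])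
      (use premise in \<open>auto simp: context_of_def\<close>)
  \<comment> \<open>With \<open>E = None\<close>, the premises from \<open>S\<^sub>2\<close> receive
    nothing on the right, so \<open>premise\<close> covers them exactly as it covers those from
    \<open>S\<^sub>1\<close>.\<close>
  have left: "derivable ar G ?\<S> ({} \<union> {?\<sigma> (principal ar c)}, None)"
    by (rule derivable.left[OF L is_substitution_truth_subst])
      (use premise in \<open>force simp: is_sequent_def context_of_def\<close>)+
  have "derivable ar G ?\<S> ({}, None)"
    using derivable.cut[OF right left] by simp
  then show False
    using assms(2) by (simp add: strongly_consistent_def)
qed

end
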